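(* Let $\hat{k}$ be the standard two-part code MDL estimator $$\hat{k}=\arg\min_k\left[\sum_{i=1}^n\ln\frac{1}{p_k(X_i)}+\ln\frac{1}{\pi_k}\right].$$ Then for every $f:\mathcal{X}\to[-1,1]$, $$\mathbf{E}_X\left|\mathbf{E}_{p_{\hat{k}}}f(x)-\frac1n\sum_{i=1}^nf(X_i)\right|\le 2A_n+\sqrt{2A_n},$$ where $A_n=\inf_k\left[D_{\mathrm{KL}}(q\|p_k)+\frac1n\ln\frac{1}{\pi_k}\right]+\frac{\ln 2}{n}$.
   Context: $\mathcal{X}$ is a sample space with a measure $\mu$; $q$ is a probability density with respect to $\mu$ (the true density); $X=(X_1,\dots,X_n)$ are $n$ independent samples from $q$; $\mathbf{E}_X$ is expectation over $X$. The model class is countable: $p_1,p_2,\dots$ are probability densities with respect to $\mu$ ($q$ need not be among them), with prior weights $\pi_j>0$, $\sum_j\pi_j=1$, not depending on $X$. $\mathbf{E}_{p}f(x)=\int f(x)p(x)\,d\mu(x)$, and $D_{\mathrm{KL}}(q\|p)=\int q\ln(q/p)\,d\mu$. The minimizer $\hat{k}=\hat k(X)$ is assumed to exist, and all quantities (including $f$) are assumed measurable. *)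

theory Defs
  imports "HOL-Probability.Probability"
begin

definition prob_density :: "'a measure \<Rightarrow> ('a \<Rightarrow> real) \<Rightarrow> bool" where
  "prob_density \<mu> p \<longleftrightarrow>
     p \<in> borel_measurable \<mu> \<and> (\<forall>x\<in>space \<mu>. 0 \<le> p x) \<and> (\<integral>\<^sup>+x. ennreal (p x) \<partial>\<mu>) = 1"

text \<open>The value of \<open>ln (1 / t)\<close> for \<open>t \<ge> 0\<close>, with \<open>ln (1 / 0) = \<infinity>\<close>.\<close>

definition ln_inv :: "real \<Rightarrow> ereal" where
  "ln_inv t = (if t = 0 then \<infinity> else ereal (ln (1 / t)))"

text \<open>
  The integral of \<open>q ln (q / p)\<close> in the extended reals, as integral of the positive part minus
  integral of the negative part (\<open>e2ennreal\<close> sends negative arguments to 0), where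
  \<open>0 ln (0 / t) = 0\<close> and \<open>s ln (s / 0) = \<infinity>\<close> for \<open>s > 0\<close>.  For probability densities the negative
  part has a finite integral, because \<open>q ln (p / q) \<le> p - q\<close>, so \<open>\<infinity> - \<infinity>\<close> does not arise.
\<close>

definition KL_integrand :: "real \<Rightarrow> real \<Rightarrow> ereal" where
  "KL_integrand s t =
     (if s = 0 then 0 else if t = 0 then \<infinity> else ereal (s * ln (s / t)))"

definition KL_div :: "'a measure \<Rightarrow> ('a \<Rightarrow> real) \<Rightarrow> ('a \<Rightarrow> real) \<Rightarrow> ereal" where
  "KL_div \<mu> q p =
     enn2ereal (\<integral>\<^sup>+x. e2ennreal (KL_integrand (q x) (p x)) \<partial>\<mu>)
     - enn2ereal (\<integral>\<^sup>+x. e2ennreal (- KL_integrand (q x) (p x)) \<partial>\<mu>)"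

text \<open>A sample of size \<open>n\<close> is a function \<open>x\<close> on \<open>{..<n}\<close>.\<close>

definition code_length ::
    "nat \<Rightarrow> ('k \<Rightarrow> 'a \<Rightarrow> real) \<Rightarrow> ('k \<Rightarrow> real) \<Rightarrow> (nat \<Rightarrow> 'a) \<Rightarrow> 'k \<Rightarrow> ereal" where
  "code_length n p \<pi> x k = (\<Sum>i<n. ln_inv (p k (x i))) + ln_inv (\<pi> k)"

definition redundancy ::
    "nat \<Rightarrow> 'a measure \<Rightarrow> ('a \<Rightarrow> real) \<Rightarrow> ('k \<Rightarrow> 'a \<Rightarrow> real) \<Rightarrow> ('k \<Rightarrow> real) \<Rightarrow> ereal" where
  "redundancy n \<mu> q p \<pi> =
     (INF k. KL_div \<mu> q (p k) + ereal (1 / real n) * ln_inv (\<pi> k)) + ereal (ln 2 / real n)"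

definition ereal_sqrt :: "ereal \<Rightarrow> ereal" where
  "ereal_sqrt a = (if a = \<infinity> then \<infinity> else ereal (sqrt (real_of_ereal a)))"

end

theory Submission
  imports Defs
begin

text \<open>
  The proof establishes the sharper bound \<open>w \<le> sqrt (2 * A)\<close> for the expected deviation \<open>w\<close>
  on the left-hand side.

  Write \<open>S k\<close> for the sum of the \<open>n\<close> centred values \<open>f (X i) - c k\<close>, where \<open>c k\<close> is the mean of \<open>f\<close>
  under \<open>p k\<close>, and \<open>R k\<close> for the likelihood ratio of \<open>p k\<close> against \<open>q\<close> on the sample; then \<open>n * w\<close>
  is the expectation of \<open>\<bar>S khat\<bar>\<close>, where \<open>khat\<close> is the selected model. For a fixed
  model \<open>k\<close> the factor \<open>R k\<close> changes the measure: the expectation of \<open>R k * exp (l * S k)\<close> is at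
  most the one of \<open>exp (l * S k)\<close> under independent samples from \<open>p k\<close>, where the summands of \<open>S k\<close>
  have mean zero and range of width 2, so Hoeffding's lemma bounds it by \<open>exp (n * l\<^sup>2 / 2)\<close>
  (\<open>tilted_likelihood_ratio_le\<close>). Passing to \<open>\<bar>S k\<bar>\<close> costs a factor 2, which becomes the \<open>ln 2 / n\<close>
  in \<open>A\<close>. The prior weights sum to 1, so the same bound holds for the mixture over all models, and
  the mixture dominates its term at any data-dependent model: this makes the bound uniform over
  selection rules (\<open>penalized_likelihood_ratio_le\<close>).

  The minimality of the two-part code length enters only here: \<open>\<pi> k * R k\<close> at the selected model is
  at least \<open>\<pi> j * R j\<close> for any competitor \<open>j\<close>, and \<open>j\<close> does not depend on the data. So
  \<open>exp (l * \<bar>S khat\<bar> + ln (\<pi> j) + ln (R j))\<close> has expectation at most \<open>2 * exp (n * l\<^sup>2 / 2)\<close>, and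
  Jensen's inequality gives
  \<open>n * l * w + ln (\<pi> j) - n * KL \<le> ln 2 + n * l\<^sup>2 / 2\<close>, because \<open>ln (R j)\<close> has expectation
  \<open>- n * KL\<close>, with \<open>KL\<close> the divergence of \<open>q\<close> from \<open>p j\<close> (for an infinite \<open>KL\<close> there is nothing
  to show). The choice \<open>l = w\<close> turns this into
  \<open>w\<^sup>2 / 2 \<le> KL + ln (1 / \<pi> j) / n + ln 2 / n\<close> (\<open>MDL_deviation_sq_le\<close>), and the infimum over \<open>j\<close>
  is \<open>w\<^sup>2 / 2 \<le> A\<close>. In particular \<open>A \<ge> 0\<close>, so adding \<open>2 * A\<close> on the right is harmless.
\<close>

section \<open>Means and exponential moments under a density\<close>

lemma abs_mean_le_1:
  assumes p: "prob_density \<mu> p"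
    and f: "f \<in> borel_measurable \<mu>" "\<And>x. x \<in> space \<mu> \<Longrightarrow> f x \<in> {-1..1}"
  shows "\<bar>\<integral>x. f x * p x \<partial>\<mu>\<bar> \<le> 1"
proof -
  have [measurable]: "p \<in> borel_measurable \<mu>" "f \<in> borel_measurable \<mu>"
    and p0: "\<And>x. x \<in> space \<mu> \<Longrightarrow> 0 \<le> p x" and p1: "(\<integral>\<^sup>+x. ennreal (p x) \<partial>\<mu>) = 1"
    using p f unfolding prob_density_def by auto
  have int: "integrable \<mu> p"
    using p0 p1 by (intro integrableI_nonneg) (auto intro: AE_I2)
  have "\<bar>\<integral>x. f x * p x \<partial>\<mu>\<bar> \<le> (\<integral>x. p x \<partial>\<mu>)"
  proof (rule order_trans[OF integral_abs_bound], rule integral_mono')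
    fix x assume x: "x \<in> space \<mu>"
    have "\<bar>f x\<bar> \<le> 1" using f(2)[OF x] by auto
    then show "\<bar>f x * p x\<bar> \<le> p x"
      using p0[OF x] by (simp add: abs_mult mult_left_le_one_le)
  qed (use int p0 in auto)
  also have "(\<integral>x. p x \<partial>\<mu>) = 1"
    using p0 p1 by (subst integral_eq_nn_integral) (auto intro: AE_I2)
  finally show ?thesis .
qed

text \<open>
  This is Jensen's inequality for the exponential, with the moment bounded as an extended
  nonnegative integral. It follows from \<open>1 + x \<le> exp x\<close> at \<open>x = Y - ln B\<close>.
\<close>

lemma (in prob_space) expectation_le_ln_of_exponential_moment:
  assumes Y: "integrable M Y" and B: "B > 0" "(\<integral>\<^sup>+\<omega>. ennreal (exp (Y \<omega>)) \<partial>M) \<le> ennreal B"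
  shows "expectation Y \<le> ln B"
proof -
  have [measurable]: "Y \<in> borel_measurable M" using Y by auto
  have e: "integrable M (\<lambda>\<omega>. exp (Y \<omega>))"
    using B(2) by (intro integrableI_bounded) (auto simp: le_less_trans)
  have "ennreal (expectation (\<lambda>\<omega>. exp (Y \<omega>))) \<le> ennreal B"
    using B(2) e by (subst nn_integral_eq_integral [symmetric]) auto
  then have eB: "expectation (\<lambda>\<omega>. exp (Y \<omega>)) \<le> B"
    using B(1) by (simp add: ennreal_le_iff)
  have "expectation (\<lambda>\<omega>. 1 + (Y \<omega> - ln B)) \<le> expectation (\<lambda>\<omega>. exp (Y \<omega>) / B)"
  proof (rule integral_mono)
    fix \<omega>
    show "1 + (Y \<omega> - ln B) \<le> exp (Y \<omega>) / B"
      using exp_ge_add_one_self[of "Y \<omega> - ln B"] B(1) by (simp add: exp_diff)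
  qed (use Y e in auto)
  also have "\<dots> \<le> 1"
    using eB B(1) by simp
  finally show ?thesis
    using Y by (simp add: prob_space)
qed

text \<open>
  This is Hoeffding's lemma for a random variable with range of width 2, namely \<open>f\<close> under the
  density \<open>p\<close>; a negative \<open>l\<close> is treated by exchanging \<open>f\<close> for \<open>- f\<close>.
\<close>

lemma centred_exponential_moment_le:
  fixes \<mu> :: "'a measure" and p f :: "'a \<Rightarrow> real" and l :: real
  assumes p: "prob_density \<mu> p"
    and f: "f \<in> borel_measurable \<mu>" "\<And>x. x \<in> space \<mu> \<Longrightarrow> f x \<in> {-1..1}"
  shows "(\<integral>\<^sup>+x. ennreal (p x * exp (l * (f x - (\<integral>y. f y * p y \<partial>\<mu>)))) \<partial>\<mu>) \<le> ennreal (exp (l\<^sup>2 / 2))"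
proof -
  have pm [measurable]: "p \<in> borel_measurable \<mu>" and p0: "\<And>x. x \<in> space \<mu> \<Longrightarrow> 0 \<le> p x"
    and p1: "(\<integral>\<^sup>+x. ennreal (p x) \<partial>\<mu>) = 1"
    using p unfolding prob_density_def by auto
  let ?M = "density \<mu> (\<lambda>x. ennreal (p x))"
  interpret M: prob_space ?M
    by (rule prob_spaceI) (simp add: emeasure_density p1 cong: nn_integral_cong)
  have positive: "(\<integral>\<^sup>+x. ennreal (p x * exp (t * (g x - (\<integral>y. g y * p y \<partial>\<mu>)))) \<partial>\<mu>) \<le> ennreal (exp (t\<^sup>2 / 2))"
    if t: "t > 0" and gm [measurable]: "g \<in> borel_measurable \<mu>"
      and g: "\<And>x. x \<in> space \<mu> \<Longrightarrow> g x \<in> {-1..1}" for t :: real and g :: "'a \<Rightarrow> real"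
  proof -
    interpret interval_bounded_random_variable ?M g "-1" 1
      by unfold_locales (use g in \<open>auto intro!: AE_I2\<close>)
    have mean: "M.expectation g = (\<integral>y. g y * p y \<partial>\<mu>)"
      by (subst integral_real_density) (auto intro!: AE_I2 simp: p0 mult.commute)
    have "(\<integral>\<^sup>+x. ennreal (p x * exp (t * (g x - (\<integral>y. g y * p y \<partial>\<mu>)))) \<partial>\<mu>)
        = (\<integral>\<^sup>+x. ennreal (exp (t * (g x - M.expectation g))) \<partial>?M)"
      by (subst nn_integral_density) (auto simp: mean p0 ennreal_mult intro!: nn_integral_cong)
    also have "\<dots> \<le> ennreal (exp (t\<^sup>2 * (1 - (-1))\<^sup>2 / 8))"
      by (rule Hoeffdings_lemma_nn_integral[OF t])
    finally show ?thesis by simp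
  qed
  consider "l > 0" | "l = 0" | "l < 0" by linarith
  then show ?thesis
  proof cases
    case 1
    then show ?thesis using positive f by blast
  next
    case 2
    then show ?thesis using p1 by simp
  next
    case 3
    have "(\<integral>\<^sup>+x. ennreal (p x * exp (- l * (- f x - (\<integral>y. - f y * p y \<partial>\<mu>)))) \<partial>\<mu>) \<le> ennreal (exp ((-l)\<^sup>2 / 2))"
      using 3 f by (intro positive) (auto simp: minus_le_iff)
    moreover have "- l * (- f x - (\<integral>y. - f y * p y \<partial>\<mu>)) = l * (f x - (\<integral>y. f y * p y \<partial>\<mu>))" for x
      by (simp add: algebra_simps)
    ultimately show ?thesis by simp
  qed
qed

section \<open>Finite Kullback-Leibler divergence\<close>

text \<open>
  The negative part of the integrand is dominated by \<open>p\<close>, since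
  \<open>q * ln (p / q) \<le> q * (p / q - 1) \<le> p\<close>. So the divergence can only be infinite through its
  positive part; if it is finite, \<open>p\<close> vanishes almost nowhere on the support of \<open>q\<close> and the
  divergence is an ordinary Lebesgue integral.
\<close>

lemma KL_div_finite:
  fixes \<mu> :: "'a measure" and p q :: "'a \<Rightarrow> real"
  assumes q: "prob_density \<mu> q" and p: "prob_density \<mu> p" and fin: "KL_div \<mu> q p \<noteq> \<infinity>"
  shows "AE x in \<mu>. q x > 0 \<longrightarrow> p x > 0"
    and "integrable \<mu> (\<lambda>x. q x * ln (q x / p x))"
    and "KL_div \<mu> q p = ereal (\<integral>x. q x * ln (q x / p x) \<partial>\<mu>)"
proof -
  have [measurable]: "p \<in> borel_measurable \<mu>" "q \<in> borel_measurable \<mu>"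
    and p0: "\<And>x. x \<in> space \<mu> \<Longrightarrow> 0 \<le> p x" and q0: "\<And>x. x \<in> space \<mu> \<Longrightarrow> 0 \<le> q x"
    and p1: "(\<integral>\<^sup>+x. ennreal (p x) \<partial>\<mu>) = 1"
    using p q unfolding prob_density_def by auto
  let ?h = "\<lambda>x. q x * ln (q x / p x)"
  let ?K = "\<lambda>x. KL_integrand (q x) (p x)"
  have Km [measurable]: "?K \<in> borel_measurable \<mu>"
    unfolding KL_integrand_def by measurable
  have neg_le: "e2ennreal (- ?K x) \<le> ennreal (p x)" if x: "x \<in> space \<mu>" for x
  proof (cases "q x = 0 \<or> p x = 0")
    case True
    then show ?thesis by (auto simp: KL_integrand_def e2ennreal_neg)
  next
    case False
    then have pos: "q x > 0" "p x > 0" using p0[OF x] q0[OF x] by auto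
    have "- ?h x = q x * ln (p x / q x)" using pos by (simp add: ln_div algebra_simps)
    also have "\<dots> \<le> q x * (p x / q x - 1)"
      using pos by (intro mult_left_mono ln_le_minus_one) auto
    also have "\<dots> \<le> p x" using pos by (simp add: field_simps)
    finally show ?thesis using pos by (simp add: KL_integrand_def ennreal_leI)
  qed
  have "(\<integral>\<^sup>+x. e2ennreal (- ?K x) \<partial>\<mu>) \<le> (\<integral>\<^sup>+x. ennreal (p x) \<partial>\<mu>)"
    by (intro nn_integral_mono neg_le)
  then have neg: "(\<integral>\<^sup>+x. e2ennreal (- ?K x) \<partial>\<mu>) \<noteq> \<infinity>"
    using p1 by (auto simp: top_unique)
  have pos: "(\<integral>\<^sup>+x. e2ennreal (?K x) \<partial>\<mu>) \<noteq> \<infinity>"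
  proof
    assume "(\<integral>\<^sup>+x. e2ennreal (?K x) \<partial>\<mu>) = \<infinity>"
    then have "KL_div \<mu> q p = \<infinity>"
      using neg unfolding KL_div_def
      by (cases "\<integral>\<^sup>+x. e2ennreal (- ?K x) \<partial>\<mu>") auto
    with fin show False by simp
  qed
  have "AE x in \<mu>. e2ennreal (?K x) \<noteq> \<infinity>"
    by (rule nn_integral_PInf_AE[OF _ pos]) measurable
  then show ac: "AE x in \<mu>. q x > 0 \<longrightarrow> p x > 0"
    by (rule AE_mp) (use p0 in \<open>force intro!: AE_I2 simp: KL_integrand_def less_le\<close>)
  have eq_pos: "(\<integral>\<^sup>+x. e2ennreal (?K x) \<partial>\<mu>) = (\<integral>\<^sup>+x. ennreal (?h x) \<partial>\<mu>)"
    by (rule nn_integral_cong_AE, rule AE_mp[OF ac])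
      (use q0 in \<open>force intro!: AE_I2 simp: KL_integrand_def less_le e2ennreal_ereal\<close>)
  have eq_neg: "(\<integral>\<^sup>+x. e2ennreal (- ?K x) \<partial>\<mu>) = (\<integral>\<^sup>+x. ennreal (- ?h x) \<partial>\<mu>)"
    by (rule nn_integral_cong_AE, rule AE_mp[OF ac])
      (use q0 in \<open>force intro!: AE_I2 simp: KL_integrand_def less_le e2ennreal_ereal\<close>)
  show int: "integrable \<mu> ?h"
    using pos neg unfolding eq_pos eq_neg by (simp add: real_integrable_def)
  show "KL_div \<mu> q p = ereal (integral\<^sup>L \<mu> ?h)"
    using pos neg unfolding KL_div_def real_lebesgue_integral_def[OF int] eq_pos eq_neg
    by (cases "\<integral>\<^sup>+x. ennreal (?h x) \<partial>\<mu>"; cases "\<integral>\<^sup>+x. ennreal (- ?h x) \<partial>\<mu>") auto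
qed

section \<open>Prior weights and code lengths\<close>

lemma nn_integral_prior:
  fixes \<pi> :: "'k \<Rightarrow> real"
  assumes "\<And>k. \<pi> k > 0" "(\<pi> has_sum 1) UNIV"
  shows "(\<integral>\<^sup>+k. ennreal (\<pi> k) \<partial>count_space UNIV) = 1"
proof -
  have "Infinite_Set_Sum.abs_summable_on \<pi> UNIV"
    using has_sum_imp_summable[OF assms(2)]
    by (intro abs_summable_equivalent[THEN iffD1] summable_on_iff_abs_summable_on_real[THEN iffD1])
  then show ?thesis
    using assms by (simp add: nn_integral_conv_infsetsum less_imp_le infsetsum_infsum infsumI)
qed

lemma code_length_eq_minus_ln:
  assumes "\<And>i. i < n \<Longrightarrow> p k (x i) > 0" and "\<pi> k > 0"
  shows "code_length n p \<pi> x k = ereal (- ln (\<pi> k * (\<Prod>i<n. p k (x i))))"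
proof -
  have nz: "p k (x i) \<noteq> 0" if "i < n" for i
    using assms(1)[OF that] by simp
  have "(\<Sum>i<n. ln_inv (p k (x i))) = (\<Sum>i<n. ereal (- ln (p k (x i))))"
  proof (intro sum.cong refl)
    fix i assume "i \<in> {..<n}"
    then have "p k (x i) > 0" using assms(1) by simp
    then show "ln_inv (p k (x i)) = ereal (- ln (p k (x i)))"
      by (simp add: ln_inv_def ln_div)
  qed
  then have "code_length n p \<pi> x k = ereal (- (\<Sum>i<n. ln (p k (x i))) - ln (\<pi> k))"
    using assms(2) by (simp add: code_length_def ln_inv_def ln_div sum_negf)
  also have "(\<Sum>i<n. ln (p k (x i))) = ln (\<Prod>i<n. p k (x i))"
    using nz by (subst ln_prod) auto
  also have "- ln (\<Prod>i<n. p k (x i)) - ln (\<pi> k) = - ln (\<pi> k * (\<Prod>i<n. p k (x i)))"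
    using nz assms(2) by (subst ln_mult) auto
  finally show ?thesis .
qed

text \<open>
  A shorter code means a larger prior-weighted likelihood. A model that assigns density 0 to some
  sample point has infinite code length and cannot beat \<open>j\<close>, so both code lengths are negative
  logarithms of positive numbers.
\<close>

lemma posterior_weight_le_if_code_length_le:
  assumes j: "\<And>i. i < n \<Longrightarrow> p j (x i) > 0" and k: "\<And>i. i < n \<Longrightarrow> p k (x i) \<ge> 0"
    and prior: "\<pi> j > 0" "\<pi> k > 0"
    and le: "code_length n p \<pi> x k \<le> code_length n p \<pi> x j"
  shows "\<pi> j * (\<Prod>i<n. p j (x i)) \<le> \<pi> k * (\<Prod>i<n. p k (x i))"
proof -
  have "code_length n p \<pi> x k \<noteq> \<infinity>"
    using le code_length_eq_minus_ln[of n p j x \<pi>] j prior(1) by auto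
  then have "(\<Sum>i<n. ln_inv (p k (x i))) \<noteq> \<infinity>"
    by (auto simp: code_length_def)
  then have "p k (x i) \<noteq> 0" if "i < n" for i
    using that by (auto simp: sum_Pinfty ln_inv_def split: if_splits)
  with k have k': "p k (x i) > 0" if "i < n" for i
    using that by (simp add: less_le)
  have pos: "\<pi> j * (\<Prod>i<n. p j (x i)) > 0" "\<pi> k * (\<Prod>i<n. p k (x i)) > 0"
    using j k' prior by (auto intro!: mult_pos_pos prod_pos)
  have "ln (\<pi> j * (\<Prod>i<n. p j (x i))) \<le> ln (\<pi> k * (\<Prod>i<n. p k (x i)))"
    using le code_length_eq_minus_ln[of n p j x \<pi>] code_length_eq_minus_ln[of n p k x \<pi>] j k' prior
    by simp
  with pos show ?thesis by simp
qed

section \<open>Change of measure on an independent sample\<close>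

locale iid_sample = prob_space P for P :: "'w measure" +
  fixes \<mu> :: "'a measure" and q :: "'a \<Rightarrow> real" and n :: nat and X :: "nat \<Rightarrow> 'w \<Rightarrow> 'a"
  assumes density_q: "prob_density \<mu> q"
    and indep_X: "indep_vars (\<lambda>_. \<mu>) X {..<n}"
    and distributed_X: "\<And>i. i < n \<Longrightarrow> distributed P \<mu> (X i) (\<lambda>x. ennreal (q x))"
begin

lemma measurable_q [measurable]: "q \<in> borel_measurable \<mu>"
  and q_nonneg: "x \<in> space \<mu> \<Longrightarrow> 0 \<le> q x"
  using density_q unfolding prob_density_def by auto

lemma measurable_X [measurable]: "i < n \<Longrightarrow> X i \<in> measurable P \<mu>"
  using distributed_X by (rule distributed_measurable)

lemma AE_X:
  assumes "AE x in \<mu>. q x > 0 \<longrightarrow> Q x" and [measurable]: "Measurable.pred \<mu> Q"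
  shows "AE \<omega> in P. \<forall>i<n. Q (X i \<omega>)"
proof -
  have "AE \<omega> in P. Q (X i \<omega>)" if i: "i < n" for i
  proof -
    have "AE x in distr P \<mu> (X i). Q x"
      unfolding distributed_distr_eq_density[OF distributed_X[OF i]]
      using assms(1) by (subst AE_density) auto
    then show ?thesis
      using i by (subst (asm) AE_distr_iff) auto
  qed
  then show ?thesis by (simp add: AE_all_countable)
qed

text \<open>
  Both factors are products over the sample, so independence splits the expectation into \<open>n\<close>
  integrals of \<open>q * (p / q) * exp (l * (f - c)) \<le> p * exp (l * (f - c))\<close>. This is an
  inequality only because the left-hand side is 0 where \<open>q\<close> vanishes, and \<open>p\<close> may have mass there.
\<close>

lemma tilted_likelihood_ratio_le:
  fixes l :: real
  assumes p: "prob_density \<mu> p"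
    and f: "f \<in> borel_measurable \<mu>" "\<And>x. x \<in> space \<mu> \<Longrightarrow> f x \<in> {-1..1}"
  shows "(\<integral>\<^sup>+\<omega>. ennreal ((\<Prod>i<n. p (X i \<omega>) / q (X i \<omega>))
            * exp (l * (\<Sum>i<n. f (X i \<omega>) - (\<integral>x. f x * p x \<partial>\<mu>)))) \<partial>P) \<le> ennreal (exp (n * l\<^sup>2 / 2))"
proof -
  let ?c = "\<integral>x. f x * p x \<partial>\<mu>"
  let ?g = "\<lambda>x. p x / q x * exp (l * (f x - ?c))"
  have [measurable]: "p \<in> borel_measurable \<mu>" "f \<in> borel_measurable \<mu>"
    and p0: "\<And>x. x \<in> space \<mu> \<Longrightarrow> 0 \<le> p x"
    using p f unfolding prob_density_def by auto
  have g0: "0 \<le> ?g x" if "x \<in> space \<mu>" for x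
    using p0[OF that] q_nonneg[OF that] by simp
  have single: "(\<integral>\<^sup>+\<omega>. ennreal (?g (X i \<omega>)) \<partial>P) \<le> ennreal (exp (l\<^sup>2 / 2))" if i: "i < n" for i
  proof -
    have "(\<integral>\<^sup>+\<omega>. ennreal (?g (X i \<omega>)) \<partial>P) = (\<integral>\<^sup>+x. ennreal (q x) * ennreal (?g x) \<partial>\<mu>)"
      by (rule distributed_nn_integral[OF distributed_X[OF i], symmetric]) measurable
    also have "\<dots> \<le> (\<integral>\<^sup>+x. ennreal (p x * exp (l * (f x - ?c))) \<partial>\<mu>)"
    proof (rule nn_integral_mono)
      fix x assume x: "x \<in> space \<mu>"
      show "ennreal (q x) * ennreal (?g x) \<le> ennreal (p x * exp (l * (f x - ?c)))"
        using p0[OF x] q_nonneg[OF x] by (cases "q x = 0") (auto simp flip: ennreal_mult)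
    qed
    also have "\<dots> \<le> ennreal (exp (l\<^sup>2 / 2))"
      by (rule centred_exponential_moment_le[OF p f])
    finally show ?thesis .
  qed
  have "(\<integral>\<^sup>+\<omega>. ennreal ((\<Prod>i<n. p (X i \<omega>) / q (X i \<omega>)) * exp (l * (\<Sum>i<n. f (X i \<omega>) - ?c))) \<partial>P)
      = (\<integral>\<^sup>+\<omega>. (\<Prod>i<n. ennreal (?g (X i \<omega>))) \<partial>P)"
  proof (rule nn_integral_cong)
    fix \<omega> assume "\<omega> \<in> space P"
    then have "X i \<omega> \<in> space \<mu>" if "i < n" for i
      using measurable_space[OF measurable_X[OF that]] by simp
    then have "(\<Prod>i<n. ennreal (?g (X i \<omega>))) = ennreal (\<Prod>i<n. ?g (X i \<omega>))"
      by (intro prod_ennreal g0) auto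
    also have "(\<Prod>i<n. ?g (X i \<omega>)) = (\<Prod>i<n. p (X i \<omega>) / q (X i \<omega>)) * exp (l * (\<Sum>i<n. f (X i \<omega>) - ?c))"
      by (simp only: prod.distrib exp_sum[OF finite_lessThan] sum_distrib_left)
    finally show "ennreal ((\<Prod>i<n. p (X i \<omega>) / q (X i \<omega>)) * exp (l * (\<Sum>i<n. f (X i \<omega>) - ?c)))
        = (\<Prod>i<n. ennreal (?g (X i \<omega>)))" by simp
  qed
  also have "\<dots> = (\<Prod>i<n. \<integral>\<^sup>+\<omega>. ennreal (?g (X i \<omega>)) \<partial>P)"
    by (rule indep_vars_nn_integral) (auto intro: indep_vars_compose2[OF indep_X])
  also have "\<dots> \<le> (\<Prod>i<n. ennreal (exp (l\<^sup>2 / 2)))"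
    by (intro prod_mono_ennreal single) simp
  also have "\<dots> = ennreal (exp (n * l\<^sup>2 / 2))"
    by (simp add: ennreal_power exp_of_nat_mult[symmetric])
  finally show ?thesis .
qed

text \<open>
  The factor 2 comes from \<open>exp \<bar>x\<bar> \<le> exp x + exp (- x)\<close>.
\<close>

lemma tilted_likelihood_ratio_abs_le:
  fixes l :: real
  assumes p: "prob_density \<mu> p"
    and f: "f \<in> borel_measurable \<mu>" "\<And>x. x \<in> space \<mu> \<Longrightarrow> f x \<in> {-1..1}"
  shows "(\<integral>\<^sup>+\<omega>. ennreal ((\<Prod>i<n. p (X i \<omega>) / q (X i \<omega>))
            * exp (l * \<bar>\<Sum>i<n. f (X i \<omega>) - (\<integral>x. f x * p x \<partial>\<mu>)\<bar>)) \<partial>P) \<le> ennreal (2 * exp (n * l\<^sup>2 / 2))"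
proof -
  let ?S = "\<lambda>\<omega>. \<Sum>i<n. f (X i \<omega>) - (\<integral>x. f x * p x \<partial>\<mu>)"
  let ?R = "\<lambda>\<omega>. \<Prod>i<n. p (X i \<omega>) / q (X i \<omega>)"
  have [measurable]: "p \<in> borel_measurable \<mu>" "f \<in> borel_measurable \<mu>"
    and p0: "\<And>x. x \<in> space \<mu> \<Longrightarrow> 0 \<le> p x"
    using p f unfolding prob_density_def by auto
  have R0: "0 \<le> ?R \<omega>" if "\<omega> \<in> space P" for \<omega>
    using measurable_space[OF measurable_X that] p0 q_nonneg by (intro prod_nonneg) auto
  have "(\<integral>\<^sup>+\<omega>. ennreal (?R \<omega> * exp (l * \<bar>?S \<omega>\<bar>)) \<partial>P)
      \<le> (\<integral>\<^sup>+\<omega>. ennreal (?R \<omega> * exp (l * ?S \<omega>)) + ennreal (?R \<omega> * exp (- l * ?S \<omega>)) \<partial>P)"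
  proof (rule nn_integral_mono)
    fix \<omega> assume "\<omega> \<in> space P"
    note R0[OF this]
    moreover have "exp (l * \<bar>?S \<omega>\<bar>) \<le> exp (l * ?S \<omega>) + exp (- l * ?S \<omega>)"
      by (cases "?S \<omega> \<ge> 0") auto
    ultimately have "?R \<omega> * exp (l * \<bar>?S \<omega>\<bar>) \<le> ?R \<omega> * exp (l * ?S \<omega>) + ?R \<omega> * exp (- l * ?S \<omega>)"
      by (subst distrib_left [symmetric]) (rule mult_left_mono)
    then have "ennreal (?R \<omega> * exp (l * \<bar>?S \<omega>\<bar>))
        \<le> ennreal (?R \<omega> * exp (l * ?S \<omega>) + ?R \<omega> * exp (- l * ?S \<omega>))"
      by (rule ennreal_leI)
    also have "\<dots> = ennreal (?R \<omega> * exp (l * ?S \<omega>)) + ennreal (?R \<omega> * exp (- l * ?S \<omega>))"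
      using \<open>0 \<le> ?R \<omega>\<close> by (intro ennreal_plus mult_nonneg_nonneg) auto
    finally show "ennreal (?R \<omega> * exp (l * \<bar>?S \<omega>\<bar>))
        \<le> ennreal (?R \<omega> * exp (l * ?S \<omega>)) + ennreal (?R \<omega> * exp (- l * ?S \<omega>))" .
  qed
  also have "\<dots> = (\<integral>\<^sup>+\<omega>. ennreal (?R \<omega> * exp (l * ?S \<omega>)) \<partial>P) + (\<integral>\<^sup>+\<omega>. ennreal (?R \<omega> * exp (- l * ?S \<omega>)) \<partial>P)"
    by (rule nn_integral_add) measurable
  also have "\<dots> \<le> ennreal (exp (n * l\<^sup>2 / 2)) + ennreal (exp (n * (- l)\<^sup>2 / 2))"
    by (intro add_mono tilted_likelihood_ratio_le assms)
  also have "\<dots> = ennreal (2 * exp (n * l\<^sup>2 / 2))"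
    by (simp flip: ennreal_plus)
  finally show ?thesis .
qed


section \<open>Deviation bound for the selected model\<close>

text \<open>
  The rule \<open>khat\<close> may depend on the sample in any way: weighting by the prior turns the selected term into one term of a mixture over all models, and each component
  of the mixture obeys the bound for a fixed model.
\<close>

lemma penalized_likelihood_ratio_le:
  fixes p :: "'k::countable \<Rightarrow> 'a \<Rightarrow> real" and khat :: "'w \<Rightarrow> 'k" and l :: real
  assumes p: "\<And>k. prob_density \<mu> (p k)"
    and prior: "\<And>k. \<pi> k > 0" "(\<pi> has_sum 1) UNIV"
    and f: "f \<in> borel_measurable \<mu>" "\<And>x. x \<in> space \<mu> \<Longrightarrow> f x \<in> {-1..1}"
  shows "(\<integral>\<^sup>+\<omega>. ennreal (\<pi> (khat \<omega>) * ((\<Prod>i<n. p (khat \<omega>) (X i \<omega>) / q (X i \<omega>))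
            * exp (l * \<bar>\<Sum>i<n. f (X i \<omega>) - (\<integral>x. f x * p (khat \<omega>) x \<partial>\<mu>)\<bar>))) \<partial>P)
          \<le> ennreal (2 * exp (n * l\<^sup>2 / 2))"
proof -
  let ?E = "\<lambda>k \<omega>. (\<Prod>i<n. p k (X i \<omega>) / q (X i \<omega>))
            * exp (l * \<bar>\<Sum>i<n. f (X i \<omega>) - (\<integral>x. f x * p k x \<partial>\<mu>)\<bar>)"
  have [measurable]: "p k \<in> borel_measurable \<mu>" "f \<in> borel_measurable \<mu>" for k
    using p f unfolding prob_density_def by auto
  have "(\<integral>\<^sup>+\<omega>. ennreal (\<pi> (khat \<omega>) * ?E (khat \<omega>) \<omega>) \<partial>P)
      \<le> (\<integral>\<^sup>+\<omega>. \<integral>\<^sup>+k. ennreal (\<pi> k) * ennreal (?E k \<omega>) \<partial>count_space UNIV \<partial>P)"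
  proof (rule nn_integral_mono)
    fix \<omega>
    show "ennreal (\<pi> (khat \<omega>) * ?E (khat \<omega>) \<omega>)
        \<le> (\<integral>\<^sup>+k. ennreal (\<pi> k) * ennreal (?E k \<omega>) \<partial>count_space UNIV)"
      using nn_integral_ge_point[of "khat \<omega>" UNIV "\<lambda>k. ennreal (\<pi> k) * ennreal (?E k \<omega>)"]
      by (simp add: ennreal_mult' prior(1) less_imp_le)
  qed
  also have "\<dots> = (\<integral>\<^sup>+k. \<integral>\<^sup>+\<omega>. ennreal (\<pi> k) * ennreal (?E k \<omega>) \<partial>P \<partial>count_space UNIV)"
    by (rule nn_integral_count_space_nn_integral) (rule countableI_type, measurable)
  also have "\<dots> = (\<integral>\<^sup>+k. ennreal (\<pi> k) * (\<integral>\<^sup>+\<omega>. ennreal (?E k \<omega>) \<partial>P) \<partial>count_space UNIV)"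
    by (intro nn_integral_cong nn_integral_cmult) measurable
  also have "\<dots> \<le> (\<integral>\<^sup>+k. ennreal (\<pi> k) * ennreal (2 * exp (n * l\<^sup>2 / 2)) \<partial>count_space UNIV)"
    by (intro nn_integral_mono mult_left_mono tilted_likelihood_ratio_abs_le p f) auto
  also have "\<dots> = ennreal (2 * exp (n * l\<^sup>2 / 2))"
    by (subst nn_integral_multc) (auto simp: nn_integral_prior[OF prior])
  finally show ?thesis .
qed

lemma expected_log_likelihood_ratio:
  fixes K :: real
  assumes p: "prob_density \<mu> p" and K: "KL_div \<mu> q p = ereal K"
  shows "integrable P (\<lambda>\<omega>. \<Sum>i<n. ln (q (X i \<omega>) / p (X i \<omega>)))"
    and "expectation (\<lambda>\<omega>. \<Sum>i<n. ln (q (X i \<omega>) / p (X i \<omega>))) = n * K"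
proof -
  have [measurable]: "p \<in> borel_measurable \<mu>"
    using p unfolding prob_density_def by auto
  have "KL_div \<mu> q p \<noteq> \<infinity>" using K by simp
  note KL = KL_div_finite[OF density_q p this]
  have int: "integrable P (\<lambda>\<omega>. ln (q (X i \<omega>) / p (X i \<omega>)))" if "i < n" for i
    using distributed_integrable[OF distributed_X[OF that], of "\<lambda>x. ln (q x / p x)"] KL(2) q_nonneg
    by simp
  have "expectation (\<lambda>\<omega>. ln (q (X i \<omega>) / p (X i \<omega>))) = K" if "i < n" for i
    using distributed_integral[OF distributed_X[OF that], of "\<lambda>x. ln (q x / p x)"] KL(3) K q_nonneg
    by simp
  with int show "expectation (\<lambda>\<omega>. \<Sum>i<n. ln (q (X i \<omega>) / p (X i \<omega>))) = n * K"
    by (simp add: Bochner_Integration.integral_sum)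
  show "integrable P (\<lambda>\<omega>. \<Sum>i<n. ln (q (X i \<omega>) / p (X i \<omega>)))"
    using int by auto
qed

text \<open>
  The competitor \<open>j\<close> is fixed in advance. It replaces the selected model in the likelihood ratio,
  because for a fixed model the expected log likelihood ratio is \<open>- n\<close> times the divergence.
\<close>

lemma MDL_deviation_sq_le:
  fixes p :: "'k::countable \<Rightarrow> 'a \<Rightarrow> real" and khat :: "'w \<Rightarrow> 'k"
  assumes n: "n \<ge> 1"
    and p: "\<And>k. prob_density \<mu> (p k)"
    and prior: "\<And>k. \<pi> k > 0" "(\<pi> has_sum 1) UNIV"
    and khat [measurable]: "khat \<in> measurable P (count_space UNIV)"
    and opt: "AE \<omega> in P. code_length n p \<pi> (\<lambda>i. X i \<omega>) (khat \<omega>) \<le> code_length n p \<pi> (\<lambda>i. X i \<omega>) j"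
    and f: "f \<in> borel_measurable \<mu>" "\<And>x. x \<in> space \<mu> \<Longrightarrow> f x \<in> {-1..1}"
    and K: "KL_div \<mu> q (p j) = ereal K"
  shows "(expectation (\<lambda>\<omega>. \<bar>(\<integral>x. f x * p (khat \<omega>) x \<partial>\<mu>) - 1 / n * (\<Sum>i<n. f (X i \<omega>))\<bar>))\<^sup>2 / 2
          \<le> K + 1 / n * ln (1 / \<pi> j) + ln 2 / n"
proof -
  define c where "c k = (\<integral>x. f x * p k x \<partial>\<mu>)" for k
  define S where "S \<omega> = (\<Sum>i<n. f (X i \<omega>) - c (khat \<omega>))" for \<omega>
  define w where "w = expectation (\<lambda>\<omega>. \<bar>S \<omega>\<bar>) / n"
  define L where "L \<omega> = (\<Sum>i<n. ln (q (X i \<omega>) / p j (X i \<omega>)))" for \<omega>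
  \<comment> \<open>The coefficient of \<open>\<bar>S \<omega>\<bar>\<close> is the bounded quantity \<open>w\<close> itself: this choice of \<open>l\<close>
    maximizes \<open>l * w - l\<^sup>2 / 2\<close>.\<close>
  define Y where "Y \<omega> = w * \<bar>S \<omega>\<bar> + ln (\<pi> j) - L \<omega>" for \<omega>
  have [measurable]: "\<And>k. p k \<in> borel_measurable \<mu>" "f \<in> borel_measurable \<mu>"
    and p0: "\<And>k x. x \<in> space \<mu> \<Longrightarrow> 0 \<le> p k x"
    using p f unfolding prob_density_def by auto
  have [measurable]: "(\<lambda>\<omega>. c (khat \<omega>)) \<in> borel_measurable P"
    by (rule measurable_compose[OF khat]) simp
  have Sm [measurable]: "S \<in> borel_measurable P"
    unfolding S_def by measurable
  have deviation: "\<bar>c (khat \<omega>) - 1 / n * (\<Sum>i<n. f (X i \<omega>))\<bar> = \<bar>S \<omega>\<bar> / n" for \<omega>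
  proof -
    have "c (khat \<omega>) - 1 / n * (\<Sum>i<n. f (X i \<omega>)) = - (S \<omega> / n)"
      using n by (simp add: S_def sum_subtractf field_simps)
    then show ?thesis by simp
  qed
  have S_bound: "\<bar>S \<omega>\<bar> \<le> n * 2" if "\<omega> \<in> space P" for \<omega>
  proof -
    have "\<bar>S \<omega>\<bar> \<le> (\<Sum>i<n. \<bar>f (X i \<omega>) - c (khat \<omega>)\<bar>)"
      unfolding S_def by (rule sum_abs)
    also have "\<dots> \<le> (\<Sum>i<n. 2)"
    proof (rule sum_mono)
      fix i assume "i \<in> {..<n}"
      then have "f (X i \<omega>) \<in> {-1..1}"
        using measurable_space[OF measurable_X that] f(2) by simp
      moreover have "\<bar>c (khat \<omega>)\<bar> \<le> 1"
        unfolding c_def by (rule abs_mean_le_1[OF p f])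
      ultimately show "\<bar>f (X i \<omega>) - c (khat \<omega>)\<bar> \<le> 2" by auto
    qed
    finally show ?thesis by simp
  qed
  have S_int: "integrable P (\<lambda>\<omega>. \<bar>S \<omega>\<bar>)"
    by (rule integrable_const_bound[of _ "n * 2"]) (use S_bound in auto)
  note L = expected_log_likelihood_ratio[OF p K, folded L_def]
  have Y_int: "integrable P Y" and EY: "expectation Y = n * w\<^sup>2 + ln (\<pi> j) - n * K"
    using S_int L n unfolding Y_def by (auto simp: prob_space w_def power2_eq_square)
  have "AE x in \<mu>. q x > 0 \<longrightarrow> p j x > 0"
    using KL_div_finite(1)[OF density_q p] K by auto
  then have "AE \<omega> in P. \<forall>i<n. p j (X i \<omega>) > 0"
    by (rule AE_X) measurable
  moreover have "AE \<omega> in P. \<forall>i<n. q (X i \<omega>) > 0"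
    by (rule AE_X) auto
  ultimately have exp_Y: "AE \<omega> in P. exp (Y \<omega>)
      \<le> \<pi> (khat \<omega>) * ((\<Prod>i<n. p (khat \<omega>) (X i \<omega>) / q (X i \<omega>)) * exp (w * \<bar>S \<omega>\<bar>))"
    using opt AE_space
  proof eventually_elim
    case (elim \<omega>)
    have Q: "(\<Prod>i<n. q (X i \<omega>)) > 0" using elim(2) by (intro prod_pos) auto
    have L_eq: "- L \<omega> = ln (\<Prod>i<n. p j (X i \<omega>) / q (X i \<omega>))"
    proof -
      have "ln (q (X i \<omega>) / p j (X i \<omega>)) = - ln (p j (X i \<omega>) / q (X i \<omega>))" if "i < n" for i
        using elim(1,2) that by (simp add: ln_div)
      then have "L \<omega> = - (\<Sum>i<n. ln (p j (X i \<omega>) / q (X i \<omega>)))"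
        by (simp add: L_def sum_negf)
      also have "(\<Sum>i<n. ln (p j (X i \<omega>) / q (X i \<omega>))) = ln (\<Prod>i<n. p j (X i \<omega>) / q (X i \<omega>))"
        using elim(1,2) by (intro ln_prod [symmetric]) force+
      finally show ?thesis by simp
    qed
    have "(\<Prod>i<n. p j (X i \<omega>) / q (X i \<omega>)) > 0"
      using elim(1,2) by (intro prod_pos) auto
    then have "exp (Y \<omega>) = exp (w * \<bar>S \<omega>\<bar>) * (\<pi> j * (\<Prod>i<n. p j (X i \<omega>) / q (X i \<omega>)))"
      using prior(1) by (simp add: Y_def diff_conv_add_uminus exp_add L_eq del: add_uminus_conv_diff)
    also have "\<pi> j * (\<Prod>i<n. p j (X i \<omega>) / q (X i \<omega>)) \<le> \<pi> (khat \<omega>) * (\<Prod>i<n. p (khat \<omega>) (X i \<omega>) / q (X i \<omega>))"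
    proof -
      have "X i \<omega> \<in> space \<mu>" if "i < n" for i
        using measurable_space[OF measurable_X[OF that]] elim(4) by simp
      then have "\<pi> j * (\<Prod>i<n. p j (X i \<omega>)) \<le> \<pi> (khat \<omega>) * (\<Prod>i<n. p (khat \<omega>) (X i \<omega>))"
        using elim(1,3) prior(1) p0
        by (intro posterior_weight_le_if_code_length_le[where x = "\<lambda>i. X i \<omega>"]) auto
      then show ?thesis
        using Q by (simp add: prod_dividef divide_right_mono)
    qed
    finally show ?case by (simp add: mult_ac)
  qed
  have "(\<integral>\<^sup>+\<omega>. ennreal (exp (Y \<omega>)) \<partial>P)
      \<le> (\<integral>\<^sup>+\<omega>. ennreal (\<pi> (khat \<omega>) * ((\<Prod>i<n. p (khat \<omega>) (X i \<omega>) / q (X i \<omega>)) * exp (w * \<bar>S \<omega>\<bar>))) \<partial>P)"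
    using exp_Y by (intro nn_integral_mono_AE) (auto intro: ennreal_leI)
  also have "\<dots> \<le> ennreal (2 * exp (n * w\<^sup>2 / 2))"
    unfolding S_def c_def by (rule penalized_likelihood_ratio_le[OF p prior f])
  finally have "expectation Y \<le> ln (2 * exp (n * w\<^sup>2 / 2))"
    by (intro expectation_le_ln_of_exponential_moment Y_int) auto
  then have "n * w\<^sup>2 + ln (\<pi> j) - n * K \<le> ln 2 + n * w\<^sup>2 / 2"
    unfolding EY by (simp add: ln_mult)
  then have "n * w\<^sup>2 / 2 \<le> n * K + ln (1 / \<pi> j) + ln 2"
    using prior(1)[of j] by (simp add: ln_div)
  then have "w\<^sup>2 / 2 \<le> K + 1 / n * ln (1 / \<pi> j) + ln 2 / n"
    using n by (simp add: field_simps)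
  then show ?thesis
    unfolding c_def [symmetric] deviation by (simp add: w_def)
qed

end

theorem theorem4p4:
  fixes \<mu> :: "'a measure"
    and q :: "'a \<Rightarrow> real"
    and p :: "'k::countable \<Rightarrow> 'a \<Rightarrow> real"
    and \<pi> :: "'k \<Rightarrow> real"
    and n :: nat
    and P :: "'w measure"
    and X :: "nat \<Rightarrow> 'w \<Rightarrow> 'a"
    and khat :: "(nat \<Rightarrow> 'a) \<Rightarrow> 'k"
    and f :: "'a \<Rightarrow> real"
  defines "sample \<equiv> \<lambda>\<omega>. \<lambda>i\<in>{..<n}. X i \<omega>"
    and "A \<equiv> redundancy n \<mu> q p \<pi>"
  assumes "n \<ge> 1"
    and "prob_density \<mu> q"
    and "\<And>k. prob_density \<mu> (p k)"
    and "\<And>k. \<pi> k > 0"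
    and "(\<pi> has_sum 1) UNIV"
    and "prob_space P"
    and "prob_space.indep_vars P (\<lambda>_. \<mu>) X {..<n}"
    and "\<And>i. i < n \<Longrightarrow> distributed P \<mu> (X i) (\<lambda>x. ennreal (q x))"
    and "khat \<in> measurable (Pi\<^sub>M {..<n} (\<lambda>_. \<mu>)) (count_space UNIV)"
    and "AE \<omega> in P. is_arg_min (code_length n p \<pi> (sample \<omega>)) (\<lambda>_. True) (khat (sample \<omega>))"
    and "f \<in> borel_measurable \<mu>"
    and "\<And>x. x \<in> space \<mu> \<Longrightarrow> f x \<in> {-1..1}"
  shows "ereal (\<integral>\<omega>. \<bar>(\<integral>x. f x * p (khat (sample \<omega>)) x \<partial>\<mu>) - (1 / real n) * (\<Sum>i<n. f (X i \<omega>))\<bar> \<partial>P)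
           \<le> 2 * A + ereal_sqrt (2 * A)"
proof -
  interpret iid_sample P \<mu> q n X
    using assms by (simp add: iid_sample_def iid_sample_axioms_def)
  let ?w = "\<integral>\<omega>. \<bar>(\<integral>x. f x * p (khat (sample \<omega>)) x \<partial>\<mu>) - (1 / real n) * (\<Sum>i<n. f (X i \<omega>))\<bar> \<partial>P"
  have "sample \<in> measurable P (Pi\<^sub>M {..<n} (\<lambda>_. \<mu>))"
    unfolding sample_def by (rule measurable_restrict) simp
  then have khat: "(\<lambda>\<omega>. khat (sample \<omega>)) \<in> measurable P (count_space UNIV)"
    by (rule measurable_compose) fact
  have opt: "AE \<omega> in P. code_length n p \<pi> (\<lambda>i. X i \<omega>) (khat (sample \<omega>)) \<le> code_length n p \<pi> (\<lambda>i. X i \<omega>) j" for j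
  proof -
    have "code_length n p \<pi> (sample \<omega>) = code_length n p \<pi> (\<lambda>i. X i \<omega>)" for \<omega>
      by (simp add: fun_eq_iff code_length_def sample_def)
    then show ?thesis
      using assms(12) by (auto simp: is_arg_min_def not_less elim: eventually_mono)
  qed
  have competitor: "ereal (?w\<^sup>2 / 2 - ln 2 / n) \<le> KL_div \<mu> q (p j) + ereal (1 / n) * ln_inv (\<pi> j)" for j
  proof (cases "KL_div \<mu> q (p j) = \<infinity>")
    case True
    then show ?thesis by simp
  next
    case False
    then obtain K where K: "KL_div \<mu> q (p j) = ereal K"
      using KL_div_finite(3)[OF assms(4,5)] by blast
    have "?w\<^sup>2 / 2 - ln 2 / n \<le> K + 1 / n * ln (1 / \<pi> j)"
      using MDL_deviation_sq_le[OF assms(3,5,6,7) khat opt assms(13,14) K] by linarith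
    then show ?thesis
      using assms(6)[of j] by (simp add: K ln_inv_def)
  qed
  have "ereal (?w\<^sup>2 / 2) = ereal (?w\<^sup>2 / 2 - ln 2 / n) + ereal (ln 2 / n)" by simp
  also have "\<dots> \<le> A"
    unfolding A_def redundancy_def by (intro add_right_mono INF_greatest competitor)
  finally have A: "ereal (?w\<^sup>2 / 2) \<le> A" .
  show ?thesis
  proof (cases A)
    case (real a)
    then have a: "?w\<^sup>2 \<le> 2 * a" using A by simp
    then have "?w \<le> sqrt (2 * a)" by (rule real_le_rsqrt)
    moreover have "0 \<le> 2 * a" using a zero_le_power2[of ?w] by linarith
    ultimately show ?thesis by (simp add: real ereal_sqrt_def)
  qed (use A in \<open>auto simp: ereal_sqrt_def\<close>)
qed

end
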